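(* Let $F$ be R. Thompson's group, let $K$ be a field and let $R=K[F]$ be the group ring of $F$ over $K$. For any four linear combinations $\alpha_ix_0+\beta_ix_1+\gamma_ix_2$ ($0\le i\le 3$) of the elements $x_0,x_1,x_2$ with coefficients $\alpha_i,\beta_i,\gamma_i\in K$, the system of three equations in four unknowns $u_0,u_1,u_2,u_3$ $$(\alpha_0x_0+\beta_0x_1+\gamma_0x_2)u_0=(\alpha_1x_0+\beta_1x_1+\gamma_1x_2)u_1=(\alpha_2x_0+\beta_2x_1+\gamma_2x_2)u_2=(\alpha_3x_0+\beta_3x_1+\gamma_3x_2)u_3$$ has a non-zero solution $(u_0,u_1,u_2,u_3)\in R^4$.
   Context: R. Thompson's group $F$ is the group given by the presentation $\langle x_0,x_1,x_2,\ldots \mid x_jx_i=x_ix_{j+1}\ (0\le i<j)\rangle$. A solution is non-zero if at least one of the $u_i$ is non-zero. *)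

theory Defs
  imports Main "HOL-Library.Poly_Mapping"
begin

text \<open>
  Words in the generators \<open>x\<^sub>0, x\<^sub>1, \<dots>\<close> and their formal inverses: the letter \<open>(i, True)\<close> stands
  for \<open>x\<^sub>i\<close> and \<open>(i, False)\<close> for its inverse. Thompson's group is the quotient of the monoid of
  words by the congruence generated by free cancellation and the defining relations.
\<close>

inductive thompson_eq :: "(nat \<times> bool) list \<Rightarrow> (nat \<times> bool) list \<Rightarrow> bool" where
  refl: "thompson_eq u u"
| sym: "thompson_eq u v \<Longrightarrow> thompson_eq v u"
| trans: "thompson_eq u v \<Longrightarrow> thompson_eq v w \<Longrightarrow> thompson_eq u w"
| append: "thompson_eq u u' \<Longrightarrow> thompson_eq v v' \<Longrightarrow> thompson_eq (u @ v) (u' @ v')"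
| cancel: "thompson_eq [(i, b), (i, \<not> b)] []"
| relation: "i < j \<Longrightarrow> thompson_eq [(j, True), (i, True)] [(i, True), (j + 1, True)]"

definition inv_word :: "(nat \<times> bool) list \<Rightarrow> (nat \<times> bool) list" where
  "inv_word w = rev (map (apsnd Not) w)"

lemma inv_word_Nil [simp]: "inv_word [] = []"
  by (simp add: inv_word_def)

lemma inv_word_Cons: "inv_word (a # w) = inv_word w @ [apsnd Not a]"
  by (simp add: inv_word_def)

lemma inv_word_append: "inv_word (u @ v) = inv_word v @ inv_word u"
  by (simp add: inv_word_def)

lemma inv_word_inv_word [simp]: "inv_word (inv_word w) = w"
  by (induction w) (auto simp: inv_word_Cons inv_word_append)

lemma thompson_eq_inv_left: "thompson_eq (inv_word w @ w) []"
proof (induction w)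
  case Nil
  show ?case by (simp add: thompson_eq.refl)
next
  case (Cons a w)
  obtain i b where a: "a = (i, b)" by (cases a)
  have "thompson_eq [apsnd Not a, a] []"
    using thompson_eq.cancel[of i "\<not> b"] by (simp add: a)
  then have "thompson_eq (inv_word w @ [apsnd Not a, a] @ w) (inv_word w @ [] @ w)"
    by (intro thompson_eq.append thompson_eq.refl)
  then show ?case
    using Cons.IH by (auto simp: inv_word_Cons intro: thompson_eq.trans)
qed

lemma thompson_eq_inv_right: "thompson_eq (w @ inv_word w) []"
  using thompson_eq_inv_left[of "inv_word w"] by simp

lemma thompson_eq_inv_word:
  assumes "thompson_eq u v"
  shows "thompson_eq (inv_word u) (inv_word v)"
proof -
  have "thompson_eq (inv_word u @ (v @ inv_word v)) (inv_word u @ [])"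
    by (intro thompson_eq.append thompson_eq.refl thompson_eq_inv_right)
  moreover have "thompson_eq ((inv_word u @ v) @ inv_word v) ((inv_word u @ u) @ inv_word v)"
    by (intro thompson_eq.append thompson_eq.refl thompson_eq.sym[OF assms])
  moreover have "thompson_eq ((inv_word u @ u) @ inv_word v) ([] @ inv_word v)"
    by (intro thompson_eq.append thompson_eq.refl thompson_eq_inv_left)
  ultimately show ?thesis
    by (simp, meson thompson_eq.sym thompson_eq.trans)
qed

quotient_type thompson = "(nat \<times> bool) list" / thompson_eq
  by (intro equivpI reflpI sympI transpI)
     (auto intro: thompson_eq.refl thompson_eq.sym thompson_eq.trans)

text \<open>
  The (non-commutative) group operation is written additively, as the convolution product of
  \<^typ>\<open>'a \<Rightarrow>\<^sub>0 'b\<close> is defined over additive monoids.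
\<close>

instantiation thompson :: group_add
begin

lift_definition zero_thompson :: thompson is "[]" .

lift_definition plus_thompson :: "thompson \<Rightarrow> thompson \<Rightarrow> thompson" is "(@)"
  by (rule thompson_eq.append)

lift_definition uminus_thompson :: "thompson \<Rightarrow> thompson" is inv_word
  by (rule thompson_eq_inv_word)

definition minus_thompson :: "thompson \<Rightarrow> thompson \<Rightarrow> thompson" where
  "minus_thompson a b = a + - b"

instance
proof
  fix a b c :: thompson
  show "a + b + c = a + (b + c)"
    by transfer (simp add: thompson_eq.refl)
  show "0 + a = a"
    by transfer (simp add: thompson_eq.refl)
  show "a + 0 = a"
    by transfer (simp add: thompson_eq.refl)
  show "- a + a = 0"
    by transfer (rule thompson_eq_inv_left)
  show "a + - b = a - b"
    by (simp add: minus_thompson_def)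
qed

end

lift_definition gen :: "nat \<Rightarrow> thompson" is "\<lambda>i. [(i, True)]" .

lemma gen_relation: "i < j \<Longrightarrow> gen j + gen i = gen i + gen (j + 1)"
  by transfer (simp add: thompson_eq.relation[simplified])

text \<open>
  \<^typ>\<open>thompson \<Rightarrow>\<^sub>0 'k\<close> is the group ring of Thompson's group over \<open>'k\<close>: finitely supported
  functions with the convolution product; \<^term>\<open>Poly_Mapping.single g c\<close> is the element \<open>c g\<close>.
\<close>

definition lin_comb :: "'k::field \<Rightarrow> 'k \<Rightarrow> 'k \<Rightarrow> thompson \<Rightarrow>\<^sub>0 'k" where
  "lin_comb a b c =
     Poly_Mapping.single (gen 0) a + Poly_Mapping.single (gen 1) b + Poly_Mapping.single (gen 2) c"

end

theory Submission
  imports Defs Complex_Main "HOL-Library.Nat_Bijection"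
begin

text \<open>
  If a finite set \<open>Y \<subseteq> F\<close> satisfies \<open>3 |{x\<^sub>0, x\<^sub>1, x\<^sub>2} Y| < 4 |Y|\<close>, then the ansatz that all \<open>u\<^sub>i\<close>
  are supported on \<open>Y\<close> turns the system into a homogeneous linear system over \<open>K\<close> with more
  unknowns than equations.

  To find \<open>Y\<close>, view positive elements of \<open>F\<close> as binary forests, left multiplication by \<open>x\<^sub>i\<close>
  joining the trees \<open>i\<close> and \<open>i + 1\<close>. Let \<open>Y\<close> consist of forests \<open>(a, b, c, d)\<close> where \<open>b, c\<close> lie in
  the set \<open>H\<close> of trees of height below 7, \<open>a\<close> is a left comb and \<open>d\<close> a right comb with fewer than
  \<open>N\<close> teeth from \<open>H\<close>. Weighting a tree with \<open>n\<close> leaves by \<open>z\<^sup>n\<close>, where \<open>0 < z < 1/3\<close> is chosen so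
  that \<open>H\<close> has weight 1, the set \<open>Y\<close> has weight \<open>(N z)\<^sup>2\<close>, whereas \<open>{x\<^sub>0, x\<^sub>1, x\<^sub>2} Y\<close> has weight at
  most \<open>((N + 1) z)\<^sup>2 (1 + z)\<close>. For large \<open>N\<close> the quotient is below \<open>4/3\<close>, and as the number of leaves
  is preserved, some level set of the number of leaves is as required.
\<close>

section \<open>Homogeneous linear systems\<close>

text \<open>Gaussian elimination: a pivot removes one equation and one unknown.\<close>

lemma homogeneous_system_nontrivial:
  fixes a :: "'e \<Rightarrow> 'i \<Rightarrow> 'k::field"
  assumes "finite E" "finite I" "card E < card I"
  shows "\<exists>x. (\<exists>i\<in>I. x i \<noteq> 0) \<and> (\<forall>e\<in>E. (\<Sum>i\<in>I. a e i * x i) = 0)"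
  using assms
proof (induction E arbitrary: I a rule: finite_induct)
  case empty
  then have "I \<noteq> {}" by auto
  then show ?case by (intro exI[of _ "\<lambda>_. 1"]) auto
next
  case (insert e E)
  show ?case
  proof (cases "\<forall>i\<in>I. a e i = 0")
    case True
    have "card E < card I" using insert by simp
    from insert.IH[OF insert.prems(1) this, of a] True show ?thesis by auto
  next
    case False
    then obtain p where p: "p \<in> I" "a e p \<noteq> 0" by blast
    define J where "J = I - {p}"
    have J: "finite J" "p \<notin> J" "I = insert p J" "card E < card J"
      using insert p by (auto simp: J_def)
    \<comment> \<open>Equation \<open>f\<close> minus the multiple of equation \<open>e\<close> that
      kills the unknown \<open>p\<close>.\<close>
    define b where "b f i = a f i - a f p * a e i / a e p" for f i
    obtain x where x: "\<exists>i\<in>J. x i \<noteq> 0" "\<And>f. f \<in> E \<Longrightarrow> (\<Sum>i\<in>J. b f i * x i) = 0"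
      using insert.IH[OF J(1,4), of b] by auto
    define S where "S = (\<Sum>i\<in>J. a e i * x i)"
    define y where "y = x(p := - S / a e p)"
    have y: "(\<Sum>i\<in>I. a f i * y i) = (\<Sum>i\<in>J. a f i * x i) - a f p * S / a e p" for f
    proof -
      have "(\<Sum>i\<in>J. a f i * y i) = (\<Sum>i\<in>J. a f i * x i)"
        using J(2) by (intro sum.cong) (auto simp: y_def)
      then show ?thesis using J by (simp add: y_def)
    qed
    have "(\<Sum>i\<in>J. b f i * x i) = (\<Sum>i\<in>J. a f i * x i) - a f p * S / a e p" for f
      by (simp add: b_def S_def left_diff_distrib sum_subtractf sum_distrib_left sum_divide_distrib
          mult.assoc)
    then have "\<forall>f\<in>insert e E. (\<Sum>i\<in>I. a f i * y i) = 0"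
      using x(2) p(2) by (auto simp: y S_def)
    moreover have "\<exists>i\<in>I. y i \<noteq> 0"
      using x(1) J by (auto simp: y_def)
    ultimately show ?thesis by blast
  qed
qed

section \<open>Forests as elements of Thompson's group\<close>

text \<open>
  The pairing bijection \<open>\<nat> \<times> \<nat> \<rightarrow> \<nat>\<close> lets \<open>F\<close> act on sequences of natural numbers: the generator
  \<open>x\<^sub>i\<close> replaces the entries \<open>i\<close> and \<open>i + 1\<close> by their code.
\<close>

definition join :: "nat \<Rightarrow> (nat \<Rightarrow> nat) \<Rightarrow> nat \<Rightarrow> nat" where
  "join i d k = (if k < i then d k else if k = i then prod_encode (d i, d (Suc i)) else d (Suc k))"

definition split :: "nat \<Rightarrow> (nat \<Rightarrow> nat) \<Rightarrow> nat \<Rightarrow> nat" where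
  "split i d k = (if k < i then d k else if k = i then fst (prod_decode (d i))
     else if k = Suc i then snd (prod_decode (d i)) else d (k - 1))"

lemma join_split [simp]: "join i (split i d) = d"
  by (auto simp: join_def split_def fun_eq_iff)

lemma split_join [simp]: "split i (join i d) = d"
  by (auto simp: join_def split_def fun_eq_iff not_less_eq less_Suc_eq)

lemma join_join: "i < j \<Longrightarrow> join j (join i d) = join i (join (Suc j) d)"
  by (auto simp: join_def fun_eq_iff)

fun act_word :: "(nat \<times> bool) list \<Rightarrow> (nat \<Rightarrow> nat) \<Rightarrow> nat \<Rightarrow> nat" where
  "act_word [] d = d"
| "act_word ((i, b) # w) d = (if b then join i else split i) (act_word w d)"

lemma act_word_append: "act_word (u @ v) d = act_word u (act_word v d)"
  by (induction u d rule: act_word.induct) auto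

text \<open>\<open>join i\<close> and \<open>split i\<close> are mutually inverse and joins obey the
  defining relation, so F itself acts. Elements with different actions are thus distinct.\<close>

lemma act_word_cong: "thompson_eq u v \<Longrightarrow> act_word u = act_word v"
proof (induction rule: thompson_eq.induct)
  case (append u u' v v')
  then show ?case by (simp add: act_word_append fun_eq_iff[of "act_word (_ @ _)"])
next
  case (cancel i b)
  then show ?case by (cases b) (auto simp: fun_eq_iff)
next
  case (relation i j)
  then show ?case by (intro ext) (simp add: join_join)
qed auto

lift_definition act :: "thompson \<Rightarrow> (nat \<Rightarrow> nat) \<Rightarrow> nat \<Rightarrow> nat" is act_word
  by (rule act_word_cong)

lemma act_plus: "act (g + h) d = act g (act h d)"
  by transfer (rule act_word_append)

lemma act_zero: "act 0 d = d"
  by transfer simp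

lemma act_gen: "act (gen i) d = join i d"
  by transfer simp

datatype tree = Leaf | Node tree tree

primrec leaves :: "tree \<Rightarrow> nat" where
  "leaves Leaf = 1"
| "leaves (Node l r) = leaves l + leaves r"

text \<open>The right summand acts first: the left subtree is collapsed into position
  \<open>i\<close>, the right one into \<open>Suc i\<close>, then \<open>gen i\<close> joins
  them.\<close>

primrec graft_tree :: "nat \<Rightarrow> tree \<Rightarrow> thompson" where
  "graft_tree i Leaf = 0"
| "graft_tree i (Node l r) = gen i + graft_tree (Suc i) r + graft_tree i l"

lemma gen_plus_gen: "i < j \<Longrightarrow> gen j + (gen i + h) = gen i + (gen (Suc j) + h)"
  using gen_relation[of i j] by (metis Suc_eq_plus1 add.assoc)

text \<open>All generators in \<open>graft_tree j t\<close> have index at least \<open>j\<close>, so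
  \<open>gen i\<close> moves past each by the defining relation, raising that index by one.\<close>

lemma graft_tree_gen:
  "i < j \<Longrightarrow> graft_tree j t + (gen i + h) = gen i + (graft_tree (Suc j) t + h)"
  by (induction t arbitrary: j h) (simp_all add: add.assoc gen_plus_gen)

text \<open>Leaves get code 1 rather than 0 because \<open>prod_encode (0, 0) = 0\<close> would spoil injectivity.\<close>

primrec code :: "tree \<Rightarrow> nat" where
  "code Leaf = 1"
| "code (Node l r) = prod_encode (code l, code r)"

lemma code_pos: "code t > 0"
  by (induction t) (auto simp: prod_encode_def)

lemma code_Node_neq_1: "code (Node l r) \<noteq> Suc 0"
proof -
  have "triangle n \<ge> n" for n by (induction n) auto
  from this[of "code l + code r"] show ?thesis
    using code_pos[of l] code_pos[of r] by (auto simp: prod_encode_def)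
qed

lemma inj_code: "inj code"
proof (rule injI)
  fix s t show "code s = code t \<Longrightarrow> s = t"
  proof (induction s arbitrary: t)
    case Leaf
    then show ?case using code_Node_neq_1 by (cases t) (auto dest: sym)
  next
    case (Node l r)
    then show ?case using code_Node_neq_1 by (cases t) auto
  qed
qed

text \<open>Joins shift in further leaves from the constant tail, so only entry \<open>i\<close>
  changes.\<close>

lemma act_graft_tree:
  "(\<And>j. j \<ge> i \<Longrightarrow> d j = 1) \<Longrightarrow> act (graft_tree i t) d = d(i := code t)"
proof (induction t arbitrary: i d)
  case Leaf
  then show ?case by (auto simp: act_zero)
next
  case (Node l r)
  have "act (graft_tree i l) d = d(i := code l)"
    using Node.prems by (intro Node.IH)
  moreover have "act (graft_tree (Suc i) r) (d(i := code l)) = d(i := code l, Suc i := code r)"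
    using Node.prems by (intro Node.IH) auto
  ultimately have "act (graft_tree i (Node l r)) d = join i (d(i := code l, Suc i := code r))"
    by (simp add: act_plus act_gen)
  then show ?case
    using Node.prems by (auto simp: join_def fun_eq_iff)
qed

text \<open>Trees are grafted from left to right, so each is built on an untouched tail of
  leaves.\<close>

definition forest4 :: "tree \<times> tree \<times> tree \<times> tree \<Rightarrow> thompson" where
  "forest4 = (\<lambda>(a, b, c, d). graft_tree 3 d + graft_tree 2 c + graft_tree 1 b + graft_tree 0 a)"

definition forest3 :: "tree \<times> tree \<times> tree \<Rightarrow> thompson" where
  "forest3 = (\<lambda>(a, b, c). graft_tree 2 c + graft_tree 1 b + graft_tree 0 a)"

text \<open>Acting on the all-leaf sequence shows the codes of the four trees at positions 0 to
  3.\<close>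

lemma inj_forest4: "inj forest4"
proof (rule injI)
  have *: "act (forest4 (a, b, c, d)) (\<lambda>_. 1)
      = (\<lambda>_. 1)(0 := code a, 1 := code b, 2 := code c, 3 := code d)" for a b c d
    by (simp add: forest4_def act_plus act_graft_tree)
  fix p q assume "forest4 p = forest4 q"
  moreover obtain a b c d a' b' c' d' where pq: "p = (a, b, c, d)" "q = (a', b', c', d')"
    by (metis prod_cases4)
  ultimately have eq: "((\<lambda>_. 1)(0 := code a, 1 := code b, 2 := code c, 3 := code d)) k
      = ((\<lambda>_. 1)(0 := code a', 1 := code b', 2 := code c', 3 := code d')) k" for k :: nat
    using * by metis
  from eq[of 0] eq[of 1] eq[of 2] eq[of 3] show "p = q"
    by (simp add: pq inj_eq[OF inj_code])
qed

text \<open>Moving the root's \<open>gen 0\<close> to the front past \<open>c\<close> and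
  \<open>d\<close> raises their positions from 1, 2 to 2, 3.\<close>

lemma gen_0_forest4: "gen 0 + forest4 (a, b, c, d) = forest3 (Node a b, c, d)"
  by (simp add: forest4_def forest3_def add.assoc graft_tree_gen eval_nat_numeral)

lemma gen_1_forest4: "gen 1 + forest4 (a, b, c, d) = forest3 (a, Node b c, d)"
  by (simp add: forest4_def forest3_def add.assoc graft_tree_gen eval_nat_numeral)

lemma gen_2_forest4: "gen 2 + forest4 (a, b, c, d) = forest3 (a, b, Node c d)"
  by (simp add: forest4_def forest3_def add.assoc eval_nat_numeral)

section \<open>Weighted sets of trees\<close>

definition nodes :: "tree set \<Rightarrow> tree set \<Rightarrow> tree set" where
  "nodes A B = insert Leaf (case_prod Node ` (A \<times> B))"

definition weight :: "real \<Rightarrow> tree set \<Rightarrow> real" where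
  "weight z A = (\<Sum>t\<in>A. z ^ leaves t)"

lemma finite_nodes [simp]: "finite A \<Longrightarrow> finite B \<Longrightarrow> finite (nodes A B)"
  by (simp add: nodes_def)

lemma nodes_mono: "A \<subseteq> A' \<Longrightarrow> B \<subseteq> B' \<Longrightarrow> nodes A B \<subseteq> nodes A' B'"
  by (auto simp: nodes_def)

lemma Node_in_nodes: "a \<in> A \<Longrightarrow> b \<in> B \<Longrightarrow> Node a b \<in> nodes A B"
  by (auto simp: nodes_def)

lemma weight_nodes:
  assumes "finite A" "finite B"
  shows "weight z (nodes A B) = z + weight z A * weight z B"
proof -
  have "weight z (nodes A B) = z + (\<Sum>t\<in>case_prod Node ` (A \<times> B). z ^ leaves t)"
    unfolding weight_def nodes_def using assms by (subst sum.insert) auto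
  also have "(\<Sum>t\<in>case_prod Node ` (A \<times> B). z ^ leaves t)
      = (\<Sum>(a, b)\<in>A \<times> B. z ^ leaves a * z ^ leaves b)"
    by (subst sum.reindex) (auto simp: inj_on_def power_add intro!: sum.cong)
  also have "\<dots> = weight z A * weight z B"
    by (simp add: weight_def sum_product sum.cartesian_product)
  finally show ?thesis .
qed

primrec full :: "nat \<Rightarrow> tree set" where
  "full 0 = {}"
| "full (Suc k) = nodes (full k) (full k)"

primrec left_combs :: "tree set \<Rightarrow> nat \<Rightarrow> tree set" where
  "left_combs H 0 = {}"
| "left_combs H (Suc n) = nodes (left_combs H n) H"

primrec right_combs :: "tree set \<Rightarrow> nat \<Rightarrow> tree set" where
  "right_combs H 0 = {}"
| "right_combs H (Suc n) = nodes H (right_combs H n)"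

lemma finite_full [simp]: "finite (full k)"
  by (induction k) auto

lemma finite_left_combs [simp]: "finite H \<Longrightarrow> finite (left_combs H n)"
  by (induction n) auto

lemma finite_right_combs [simp]: "finite H \<Longrightarrow> finite (right_combs H n)"
  by (induction n) auto

lemma full_mono: "full k \<subseteq> full (Suc k)"
  by (induction k) (auto intro: nodes_mono[THEN subsetD])

lemma left_combs_mono: "left_combs H n \<subseteq> left_combs H (Suc n)"
  by (induction n) (auto intro: nodes_mono[THEN subsetD])

lemma right_combs_mono: "right_combs H n \<subseteq> right_combs H (Suc n)"
  by (induction n) (auto intro: nodes_mono[THEN subsetD])

text \<open>As \<open>H\<close> has weight 1, the recursion adds just \<open>z\<close> at each
  step.\<close>

lemma weight_left_combs: "finite H \<Longrightarrow> weight z H = 1 \<Longrightarrow> weight z (left_combs H n) = n * z"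
  by (induction n) (auto simp: weight_nodes algebra_simps, simp add: weight_def)

lemma weight_right_combs: "finite H \<Longrightarrow> weight z H = 1 \<Longrightarrow> weight z (right_combs H n) = n * z"
  by (induction n) (auto simp: weight_nodes algebra_simps, simp add: weight_def)

text \<open>Iterating w -> z + w^2 from 0 at z = 1/3 first exceeds 1 after seven steps; the
  intermediate value theorem does the rest.\<close>

lemma ex_weight_full_eq_1: "\<exists>z>0. z < 1/3 \<and> weight z (full 7) = 1"
proof -
  have 0: "weight z (full 0) = 0" for z by (simp add: weight_def)
  have Suc: "weight z (full (Suc k)) = z + (weight z (full k))\<^sup>2" for z k
    by (simp add: weight_nodes power2_eq_square)
  have zero: "weight 0 (full k) = 0" for k
    by (induction k) (simp_all only: 0 Suc, simp)
  have seven: "7 = Suc (Suc (Suc (Suc (Suc (Suc (Suc 0))))))" by simp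
  have third: "weight (1/3) (full 7) > 1"
    by (simp only: seven Suc 0) (simp add: power2_eq_square)
  have "continuous_on {0..1/3} (\<lambda>z. weight z (full 7))"
    unfolding weight_def by (intro continuous_intros)
  then obtain z where "0 \<le> z" "z \<le> 1/3" "weight z (full 7) = 1"
    using IVT'[of "\<lambda>z. weight z (full 7)" 0 1 "1/3"] zero third by auto
  moreover have "z \<noteq> 0" "z \<noteq> 1/3"
    using calculation zero third by (metis zero_neq_one, metis less_irrefl)
  ultimately show ?thesis by (intro exI[of _ z]) auto
qed

section \<open>From weights to cardinalities\<close>

text \<open>Otherwise the reverse inequality on every level, multiplied by \<open>z ^ n\<close> and
  summed, contradicts \<open>less\<close>.\<close>

lemma ex_level_set_card_less:
  fixes P :: "'a set" and Q :: "'b set" and f :: "'a \<Rightarrow> nat" and g :: "'b \<Rightarrow> nat"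
    and p q :: nat and z :: real
  assumes fin: "finite P" "finite Q" and "z \<ge> 0"
    and less: "p * (\<Sum>x\<in>P. z ^ f x) < q * (\<Sum>y\<in>Q. z ^ g y)"
  shows "\<exists>n. p * card {x \<in> P. f x = n} < q * card {y \<in> Q. g y = n}"
proof (rule ccontr)
  assume "\<not> ?thesis"
  then have le: "q * card {y \<in> Q. g y = n} \<le> p * card {x \<in> P. f x = n}" for n
    by (simp add: not_less)
  define N where "N = f ` P \<union> g ` Q"
  have N: "finite N" using fin by (simp add: N_def)
  have "(\<Sum>x\<in>P. z ^ f x) = (\<Sum>n\<in>N. card {x \<in> P. f x = n} * z ^ n)"
    by (subst sum.group[OF fin(1) N, symmetric, of f]) (auto simp: N_def)
  moreover have "(\<Sum>y\<in>Q. z ^ g y) = (\<Sum>n\<in>N. card {y \<in> Q. g y = n} * z ^ n)"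
    by (subst sum.group[OF fin(2) N, symmetric, of g]) (auto simp: N_def)
  moreover have "(\<Sum>n\<in>N. real (q * card {y \<in> Q. g y = n}) * z ^ n)
      \<le> (\<Sum>n\<in>N. real (p * card {x \<in> P. f x = n}) * z ^ n)"
    using \<open>z \<ge> 0\<close> by (intro sum_mono mult_right_mono of_nat_mono le) auto
  ultimately show False
    using less by (simp add: sum_distrib_left mult.assoc)
qed

lemma ex_quadratic_growth:
  fixes r :: real
  assumes "0 \<le> r" "r < 1"
  shows "\<exists>n::nat. (real n + 1)\<^sup>2 * r < (real n)\<^sup>2"
proof -
  \<comment> \<open>Chosen so that 2n + 1 <= 3n < n^2 (1 - r).\<close>
  obtain n :: nat where n: "3 / (1 - r) < n" using reals_Archimedean2 by blast
  have "n > 0" using n assms by (cases n) (auto simp: field_simps)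
  have "(real n + 1)\<^sup>2 * r = (real n)\<^sup>2 * r + (2 * real n + 1) * r"
    by (simp add: power2_eq_square algebra_simps)
  also have "\<dots> \<le> (real n)\<^sup>2 * r + (2 * real n + 1) * 1"
    using assms by (intro add_left_mono mult_left_mono) auto
  also have "\<dots> \<le> (real n)\<^sup>2 * r + real n * 3"
    using \<open>n > 0\<close> by simp
  also have "\<dots> < (real n)\<^sup>2 * r + real n * (real n * (1 - r))"
    using n assms \<open>n > 0\<close> by (intro add_strict_left_mono mult_strict_left_mono)
      (auto simp: divide_less_eq)
  also have "\<dots> = (real n)\<^sup>2"
    by (simp add: power2_eq_square algebra_simps)
  finally show ?thesis by blast
qed

definition leaves3 :: "tree \<times> tree \<times> tree \<Rightarrow> nat" where
  "leaves3 = (\<lambda>(a, b, c). leaves a + leaves b + leaves c)"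

definition leaves4 :: "tree \<times> tree \<times> tree \<times> tree \<Rightarrow> nat" where
  "leaves4 = (\<lambda>(a, b, c, d). leaves a + leaves b + leaves c + leaves d)"

lemma sum_leaves3:
  "(\<Sum>t\<in>A \<times> B \<times> C. z ^ leaves3 t) = weight z A * weight z B * weight z C"
  unfolding weight_def leaves3_def
  by (simp add: sum.cartesian_product' power_add mult.assoc flip: sum_distrib_left sum_distrib_right)

lemma sum_leaves4:
  "(\<Sum>t\<in>A \<times> B \<times> C \<times> D. z ^ leaves4 t) = weight z A * weight z B * weight z C * weight z D"
  unfolding weight_def leaves4_def
  by (simp add: sum.cartesian_product' power_add mult.assoc flip: sum_distrib_left sum_distrib_right)

lemma ex_small_product_set:
  "\<exists>Y B :: thompson set. finite Y \<and> finite B \<and> 3 * card B < 4 * card Y \<and>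
     (\<forall>y\<in>Y. gen 0 + y \<in> B \<and> gen 1 + y \<in> B \<and> gen 2 + y \<in> B)"
proof -
  obtain z :: real where z: "z > 0" "z < 1/3" and H1: "weight z (full 7) = 1"
    using ex_weight_full_eq_1 by blast
  \<comment> \<open>Here \<open>z < 1/3\<close> enters: it makes 3(1 + z)/4 less than 1.\<close>
  obtain N :: nat where N: "(real N + 1)\<^sup>2 * (3 * (1 + z) / 4) < (real N)\<^sup>2"
    using ex_quadratic_growth[of "3 * (1 + z) / 4"] z by auto
  define H where "H = full 7"
  define H' where "H' = full (Suc 7)"
  define Q where "Q = left_combs H N \<times> H \<times> H \<times> right_combs H N"
  \<comment> \<open>Joining \<open>a\<close> with \<open>b\<close> or \<open>c\<close> with
    \<open>d\<close> adds a tooth to a comb; joining \<open>b\<close> with \<open>c\<close> leads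
    into \<open>H'\<close>. One box covers all three cases.\<close>
  define P where "P = left_combs H (Suc N) \<times> H' \<times> right_combs H (Suc N)"
  have H: "finite H" "weight z H = 1" "H \<subseteq> H'"
    using H1 full_mono[of 7] by (simp_all only: H_def H'_def finite_full)
  have H': "finite H'" "H' = nodes H H"
    by (simp_all only: H_def H'_def full.simps finite_full finite_nodes)
  have wH': "weight z H' = z + 1"
    using H by (simp add: H' weight_nodes)
  have fin: "finite P" "finite Q"
    unfolding P_def Q_def using H(1) H'(1)
    by (auto intro!: finite_cartesian_product simp del: left_combs.simps right_combs.simps)
  have "3 * (\<Sum>t\<in>P. z ^ leaves3 t) = ((real N + 1)\<^sup>2 * (3 * (1 + z) / 4)) * (4 * z\<^sup>2)"
    unfolding P_def sum_leaves3 weight_left_combs[OF H(1,2)] weight_right_combs[OF H(1,2)] wH'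
    by (simp add: power2_eq_square algebra_simps)
  also have "\<dots> < (real N)\<^sup>2 * (4 * z\<^sup>2)"
    using N z by (intro mult_strict_right_mono) auto
  also have "\<dots> = 4 * (\<Sum>t\<in>Q. z ^ leaves4 t)"
    unfolding Q_def sum_leaves4 weight_left_combs[OF H(1,2)] weight_right_combs[OF H(1,2)] H(2)
    by (simp add: power2_eq_square algebra_simps)
  finally obtain n where
    n: "3 * card {t \<in> P. leaves3 t = n} < 4 * card {t \<in> Q. leaves4 t = n}"
    using ex_level_set_card_less[OF fin, of z 3 leaves3 4 leaves4] z by auto
  \<comment> \<open>Joins keep the total number of leaves, so level \<open>n\<close> of
    \<open>Q\<close> is sent into level \<open>n\<close> of \<open>P\<close>.\<close>
  define Y where "Y = forest4 ` {t \<in> Q. leaves4 t = n}"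
  define B where "B = forest3 ` {t \<in> P. leaves3 t = n}"
  have "card Y = card {t \<in> Q. leaves4 t = n}"
    unfolding Y_def by (intro card_image inj_on_subset[OF inj_forest4]) auto
  moreover have "card B \<le> card {t \<in> P. leaves3 t = n}"
    unfolding B_def using fin by (intro card_image_le) auto
  ultimately have "3 * card B < 4 * card Y" using n by linarith
  moreover have "gen 0 + y \<in> B \<and> gen 1 + y \<in> B \<and> gen 2 + y \<in> B" if "y \<in> Y" for y
  proof -
    obtain a b c d where y: "y = forest4 (a, b, c, d)" and n: "leaves4 (a, b, c, d) = n"
      and abcd: "a \<in> left_combs H N" "b \<in> H" "c \<in> H" "d \<in> right_combs H N"
      using \<open>y \<in> Y\<close> unfolding Y_def Q_def by auto
    have "Node a b \<in> left_combs H (Suc N)" "Node b c \<in> H'" "Node c d \<in> right_combs H (Suc N)"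
      using abcd by (auto simp: H' intro: Node_in_nodes)
    moreover have "a \<in> left_combs H (Suc N)" "b \<in> H'" "c \<in> H'" "d \<in> right_combs H (Suc N)"
      using abcd left_combs_mono[of H N] right_combs_mono[of H N] H(3) by blast+
    ultimately show ?thesis
      unfolding y gen_0_forest4 gen_1_forest4 gen_2_forest4 B_def P_def
      using n by (auto simp: leaves3_def leaves4_def simp del: left_combs.simps right_combs.simps)
  qed
  ultimately show ?thesis
    using fin by (intro exI[of _ Y] exI[of _ B]) (auto simp: Y_def B_def)
qed

section \<open>The system of equations\<close>

text \<open>Turns each coefficient of the product into a linear form in the unknowns
  \<open>x y\<close>.\<close>

lemma lookup_lin_comb_times_sum:
  fixes a b c :: "'k::field" and x :: "thompson \<Rightarrow> 'k"
  shows "Poly_Mapping.lookup (lin_comb a b c * (\<Sum>y\<in>Y. Poly_Mapping.single y (x y))) g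
    = (\<Sum>y\<in>Y. ((a when gen 0 + y = g) + (b when gen 1 + y = g) + (c when gen 2 + y = g)) * x y)"
  by (auto simp: lin_comb_def sum_distrib_left distrib_right mult_single lookup_sum lookup_add
      lookup_single when_def intro!: sum.cong)

theorem corollary1:
  fixes \<alpha> \<beta> \<gamma> :: "nat \<Rightarrow> 'k::field"
  shows "\<exists>u\<^sub>0 u\<^sub>1 u\<^sub>2 u\<^sub>3 :: thompson \<Rightarrow>\<^sub>0 'k.
    (u\<^sub>0 \<noteq> 0 \<or> u\<^sub>1 \<noteq> 0 \<or> u\<^sub>2 \<noteq> 0 \<or> u\<^sub>3 \<noteq> 0) \<and>
    lin_comb (\<alpha> 0) (\<beta> 0) (\<gamma> 0) * u\<^sub>0 = lin_comb (\<alpha> 1) (\<beta> 1) (\<gamma> 1) * u\<^sub>1 \<and>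
    lin_comb (\<alpha> 1) (\<beta> 1) (\<gamma> 1) * u\<^sub>1 = lin_comb (\<alpha> 2) (\<beta> 2) (\<gamma> 2) * u\<^sub>2 \<and>
    lin_comb (\<alpha> 2) (\<beta> 2) (\<gamma> 2) * u\<^sub>2 = lin_comb (\<alpha> 3) (\<beta> 3) (\<gamma> 3) * u\<^sub>3"
proof -
  obtain Y B :: "thompson set" where fin: "finite Y" "finite B" and card: "3 * card B < 4 * card Y"
    and B: "\<And>y. y \<in> Y \<Longrightarrow> gen 0 + y \<in> B \<and> gen 1 + y \<in> B \<and> gen 2 + y \<in> B"
    using ex_small_product_set by metis
  define k where "k j y g = (\<alpha> j when gen 0 + y = g) + (\<beta> j when gen 1 + y = g)
    + (\<gamma> j when gen 2 + y = g)" for j y g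
  \<comment> \<open>Row \<open>(j, g)\<close> says that the products for \<open>j\<close> and
    \<open>Suc j\<close> agree at \<open>g\<close>; column \<open>(i, y)\<close> belongs to the
    coefficient of \<open>u i\<close> at \<open>y\<close>.\<close>
  define A where "A = (\<lambda>(j, g) (i, y). (if i = j then k j y g else if i = Suc j then - k i y g else 0))"
  have "\<exists>x. (\<exists>i\<in>{..<4} \<times> Y. x i \<noteq> 0) \<and> (\<forall>e\<in>{..<3} \<times> B. (\<Sum>i\<in>{..<4} \<times> Y. A e i * x i) = 0)"
    using fin card by (intro homogeneous_system_nontrivial) (auto simp: card_cartesian_product)
  then obtain x i y where iy: "i < 4" "y \<in> Y" "x (i, y) \<noteq> 0"
    and x: "\<And>j g. j < 3 \<Longrightarrow> g \<in> B \<Longrightarrow> (\<Sum>i\<in>{..<4} \<times> Y. A (j, g) i * x i) = 0"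
    by fast
  define u where "u j = (\<Sum>y\<in>Y. Poly_Mapping.single y (x (j, y)))" for j
  have u: "Poly_Mapping.lookup (lin_comb (\<alpha> j) (\<beta> j) (\<gamma> j) * u j) g = (\<Sum>y\<in>Y. k j y g * x (j, y))"
    for j g by (simp add: u_def lookup_lin_comb_times_sum k_def)
  have eq: "lin_comb (\<alpha> j) (\<beta> j) (\<gamma> j) * u j
    = lin_comb (\<alpha> (Suc j)) (\<beta> (Suc j)) (\<gamma> (Suc j)) * u (Suc j)" if "j < 3" for j
  proof (rule poly_mapping_eqI)
    fix g
    show "Poly_Mapping.lookup (lin_comb (\<alpha> j) (\<beta> j) (\<gamma> j) * u j) g
      = Poly_Mapping.lookup (lin_comb (\<alpha> (Suc j)) (\<beta> (Suc j)) (\<gamma> (Suc j)) * u (Suc j)) g"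
    proof (cases "g \<in> B")
      case True
      have "0 = (\<Sum>i<4. \<Sum>y\<in>Y. A (j, g) (i, y) * x (i, y))"
        using x[OF that True] by (simp add: sum.cartesian_product)
      also have "\<dots> = (\<Sum>i\<in>{j, Suc j}. \<Sum>y\<in>Y. A (j, g) (i, y) * x (i, y))"
        using that by (intro sum.mono_neutral_right) (auto simp: A_def)
      also have "\<dots> = (\<Sum>y\<in>Y. k j y g * x (j, y)) - (\<Sum>y\<in>Y. k (Suc j) y g * x (Suc j, y))"
        by (simp add: A_def sum_negf)
      finally show ?thesis by (simp add: u)
    next
      \<comment> \<open>Both sides vanish outside \<open>B\<close>, which contains
        \<open>gen i + y\<close> for all \<open>y\<close> in \<open>Y\<close> and i = 0, 1,
        2.\<close>
      case False
      then have "k i y g = 0" if "y \<in> Y" for i y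
        using B[OF that] by (auto simp: k_def when_def)
      then show ?thesis by (simp add: u)
    qed
  qed
  have "Poly_Mapping.lookup (u i) y = x (i, y)"
    using fin iy by (simp add: u_def lookup_sum lookup_single when_def)
  then have "u i \<noteq> 0" using iy by auto
  moreover have "i = 0 \<or> i = 1 \<or> i = 2 \<or> i = 3" using iy by auto
  ultimately have "u 0 \<noteq> 0 \<or> u 1 \<noteq> 0 \<or> u 2 \<noteq> 0 \<or> u 3 \<noteq> 0" by auto
  then show ?thesis
    using eq[of 0] eq[of 1] eq[of 2]
    by (intro exI[of _ "u 0"] exI[of _ "u 1"] exI[of _ "u 2"] exI[of _ "u 3"])
       (simp add: numeral_3_eq_3 numeral_2_eq_2)
qed

end
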